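(* There exist constants $c_1,c_2>0$ such that, for positive integers $m$ and $\ell$, $Q\big(\mathrm{DYCK}_{c_1\ell m,\;c_2(2m)^{\ell}}\big)=\Omega(m^{\ell})$.
   Context: For $x=x_1\cdots x_n\in\{0,1\}^n$, interpret $x_i=0$ as "(" and $x_i=1$ as ")". Let $f(y)=|y|_0-|y|_1$. $\mathrm{DYCK}_{k,n}(x)=1$ iff $f(x)=0$ and every prefix $p$ of $x$ satisfies $0\le f(p)\le k$. $Q(g)$ denotes the bounded-error quantum query complexity of $g$: the minimum number of queries to the oracle $|i\rangle|z\rangle|w\rangle\mapsto|i\rangle|z\oplus x_i\rangle|w\rangle$ made by a quantum algorithm that outputs $g(x)$ with probability at least $2/3$ on every input. *)

theory Defs
  imports
    "Jordan_Normal_Form.Schur_Decomposition"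
    "HOL-Library.Sublist"
    "HOL-Library.Landau_Symbols"
begin

text \<open>Bit strings are lists of booleans: \<^const>\<open>False\<close> is the bit 0, read as an opening
  parenthesis, and \<^const>\<open>True\<close> is the bit 1, read as a closing parenthesis.\<close>

definition balance :: "bool list \<Rightarrow> int" where
  "balance y = int (count_list y False) - int (count_list y True)"

definition dyck :: "nat \<Rightarrow> nat \<Rightarrow> bool list \<Rightarrow> bool" where
  "dyck k n x \<longleftrightarrow> length x = n \<and> balance x = 0 \<and>
     (\<forall>p. prefix p x \<longrightarrow> 0 \<le> balance p \<and> balance p \<le> int k)"

definition unitary_mat :: "nat \<Rightarrow> complex mat \<Rightarrow> bool" where
  "unitary_mat N A \<longleftrightarrow> A \<in> carrier_mat N N \<and>
     mat_adjoint A * A = 1\<^sub>m N \<and> A * mat_adjoint A = 1\<^sub>m N"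

text \<open>The state space has the basis vectors $|i\rangle|z\rangle|w\rangle$ with $i < n$ an input
  position (counted from 0), $z$ a bit and $w < d$ a workspace label. It is realised as complex
  vectors of dimension $2nd$; \<open>basis_index d i z w\<close> is the coordinate that belongs to
  $|i\rangle|z\rangle|w\rangle$, a bijection onto \<open>{..<2 * n * d}\<close>.\<close>

definition basis_index :: "nat \<Rightarrow> nat \<Rightarrow> bool \<Rightarrow> nat \<Rightarrow> nat" where
  "basis_index d i z w = (2 * i + of_bool z) * d + w"

text \<open>The oracle maps $|i\rangle|z\rangle|w\rangle$ to $|i\rangle|z\oplus x_i\rangle|w\rangle$;
  on booleans, \<open>\<noteq>\<close> is exclusive or.\<close>

definition oracle_mat :: "nat \<Rightarrow> nat \<Rightarrow> bool list \<Rightarrow> complex mat" where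
  "oracle_mat n d x = mat (2 * n * d) (2 * n * d) (\<lambda>(r, c).
     of_bool (\<exists>i<n. \<exists>z. \<exists>w<d. c = basis_index d i z w \<and> r = basis_index d i (z \<noteq> x ! i) w))"

text \<open>\<open>query_state n d U x t\<close> is $U_t O_x U_{t-1} \cdots O_x U_0 |0\rangle|0\rangle|0\rangle$,
  where the $U_j$ do not depend on the input \<open>x\<close>.\<close>

fun query_state ::
  "nat \<Rightarrow> nat \<Rightarrow> (nat \<Rightarrow> complex mat) \<Rightarrow> bool list \<Rightarrow> nat \<Rightarrow> complex vec" where
  "query_state n d U x 0 = U 0 *\<^sub>v unit_vec (2 * n * d) (basis_index d 0 False 0)"
| "query_state n d U x (Suc t) = U (Suc t) *\<^sub>v (oracle_mat n d x *\<^sub>v query_state n d U x t)"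

text \<open>The final state is measured in the basis above and the outcome \<open>j\<close> is turned into the
  answer \<open>out j\<close>.\<close>

definition output_prob ::
  "nat \<Rightarrow> nat \<Rightarrow> (nat \<Rightarrow> complex mat) \<Rightarrow> (nat \<Rightarrow> bool) \<Rightarrow> nat \<Rightarrow> bool list \<Rightarrow> bool \<Rightarrow> real" where
  "output_prob n d U out T x b =
     (\<Sum>j | j < 2 * n * d \<and> out j = b. (cmod (query_state n d U x T $ j))\<^sup>2)"

definition computable_with_queries :: "nat \<Rightarrow> (bool list \<Rightarrow> bool) \<Rightarrow> nat \<Rightarrow> bool" where
  "computable_with_queries n g T \<longleftrightarrow> (\<exists>d U out. d > 0 \<and>
     (\<forall>t\<le>T. unitary_mat (2 * n * d) (U t)) \<and>
     (\<forall>x. length x = n \<longrightarrow> output_prob n d U out T x (g x) \<ge> 2/3))"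

text \<open>The bounded-error quantum query complexity of the restriction of \<open>g\<close> to bit strings of
  length \<open>n\<close>, for \<open>n > 0\<close> (for \<open>n = 0\<close> there is no position to query and the state space is
  trivial).\<close>

definition quantum_query_complexity :: "nat \<Rightarrow> (bool list \<Rightarrow> bool) \<Rightarrow> nat" where
  "quantum_query_complexity n g = (LEAST T. computable_with_queries n g T)"

end

theory Submission
  imports Defs
begin

text \<open>Take strings of $2m$ parentheses of which $m$ or $m+1$ are closing, and iterate: a block with
  an opening parenthesis appended has balance $1$ or $-1$, so it can serve as a parenthesis one level
  up. After $l$ levels the strings have length $O((2m)^l)$, and prefix balances grow by only $m+1$ per
  level, so all of them stay within $O(lm)$; after padding, the string is in the Dyck language iff
  its top-level bit is opening. In every such string, flipping a bit at any of at least $m^l$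
  positions flips the bit at every level on the path to the root and hence exchanges members and
  nonmembers.

  For such a bipartite graph of single-bit flips the unweighted adversary argument applies. The sum of
  the real inner products of final states over all edges drops by a constant fraction of the number of
  edges. Since the endpoints of an edge differ in one position only, one query decreases this sum by at
  most the total query weight, which is at most the number of vertices, and this is at most $2/m^l$
  times the number of edges.\<close>

subsection \<open>The oracle and inner products\<close>

lemma basis_index_eq_iff:
  assumes "w < d" "w' < d"
  shows "basis_index d i z w = basis_index d i' z' w' \<longleftrightarrow> i = i' \<and> z = z' \<and> w = w'"
proof
  assume eq: "basis_index d i z w = basis_index d i' z' w'"
  have "(basis_index d i z w) div d = 2 * i + of_bool z" "(basis_index d i' z' w') div d = 2 * i' + of_bool z'"
    using assms by (simp_all add: basis_index_def)
  then have 1: "2 * i + of_bool z = 2 * i' + (of_bool z' :: nat)" using eq by simp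
  have "(basis_index d i z w) mod d = w" "(basis_index d i' z' w') mod d = w'"
    using assms by (simp_all add: basis_index_def)
  then have "w = w'" using eq by simp
  moreover have "i = i' \<and> z = z'" using 1 by (cases z; cases z') (auto, presburger+)
  ultimately show "i = i' \<and> z = z' \<and> w = w'" by simp
qed simp

lemma basis_index_less:
  assumes "i < n" "w < d"
  shows "basis_index d i z w < 2 * n * d"
proof -
  have "basis_index d i z w < (2 * i + of_bool z + 1) * d"
    using assms by (simp add: basis_index_def)
  also have "\<dots> \<le> (2 * n) * d"
    using assms by (intro mult_right_mono) (cases z; simp)+
  finally show ?thesis .
qed

lemma basis_index_cases:
  assumes "r < 2 * n * d"
  obtains i z w where "i < n" "w < d" "r = basis_index d i z w"
proof -
  have d: "d > 0" using assms by (cases d) auto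
  have q: "r div d < 2 * n"
    using assms by (simp add: less_mult_imp_div_less)
  show ?thesis
  proof
    show "r div d div 2 < n" using q by simp
    show "r mod d < d" using d by simp
    have "2 * (r div d div 2) + of_bool (odd (r div d)) = r div d"
      by (simp add: mod_2_eq_odd[symmetric])
    then show "r = basis_index d (r div d div 2) (odd (r div d)) (r mod d)"
      by (simp add: basis_index_def)
  qed
qed

lemma sum_basis_index:
  "(\<Sum>r<2 * n * d. f r) = (\<Sum>i<n. \<Sum>z\<in>UNIV. \<Sum>w<d. f (basis_index d i z w))"
proof -
  let ?g = "\<lambda>(i, z, w). basis_index d i z w"
  have "inj_on ?g ({..<n} \<times> UNIV \<times> {..<d})"
    by (auto simp: inj_on_def basis_index_eq_iff)
  moreover have "?g ` ({..<n} \<times> UNIV \<times> {..<d}) = {..<2 * n * d}"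
    by (auto simp: basis_index_less elim!: basis_index_cases intro!: rev_image_eqI)
  ultimately have "bij_betw ?g ({..<n} \<times> UNIV \<times> {..<d}) {..<2 * n * d}"
    by (simp add: bij_betw_def)
  then have "(\<Sum>r<2 * n * d. f r) = (\<Sum>p\<in>{..<n} \<times> UNIV \<times> {..<d}. f (?g p))"
    by (rule sum.reindex_bij_betw[symmetric])
  then show ?thesis
    by (simp add: sum.cartesian_product split_def)
qed

lemma cscalar_prod_conv_sum:
  fixes a b :: "complex vec"
  shows "dim_vec b = N \<Longrightarrow> a \<bullet>c b = (\<Sum>r<N. a $ r * cnj (b $ r))"
  by (simp add: scalar_prod_def atLeast0LessThan)

lemma unitary_mat_cscalar_prod:
  assumes U: "unitary_mat N U" and a: "a \<in> carrier_vec N" and b: "b \<in> carrier_vec N"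
  shows "(U *\<^sub>v a) \<bullet>c (U *\<^sub>v b) = a \<bullet>c b"
proof -
  have UN: "U \<in> carrier_mat N N" and UU: "mat_adjoint U * U = 1\<^sub>m N"
    using U by (auto simp: unitary_mat_def)
  have orth: "(\<Sum>r<N. U $$ (r, k) * cnj (U $$ (r, l))) = of_bool (l = k)"
    if "k < N" "l < N" for k l
  proof -
    have "(mat_adjoint U * U) $$ (l, k) = (\<Sum>r<N. cnj (U $$ (r, l)) * U $$ (r, k))"
      using UN that by (simp add: mat_adjoint_def scalar_prod_def atLeast0LessThan mat_of_rows_def)
    then show ?thesis
      using that by (auto simp: UU mult.commute of_bool_def)
  qed
  have "(U *\<^sub>v a) \<bullet>c (U *\<^sub>v b) = (\<Sum>r<N. (U *\<^sub>v a) $ r * cnj ((U *\<^sub>v b) $ r))"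
    by (rule cscalar_prod_conv_sum) (use UN in simp)
  also have "\<dots> = (\<Sum>r<N. (\<Sum>k<N. U $$ (r, k) * a $ k) * (\<Sum>l<N. cnj (U $$ (r, l)) * cnj (b $ l)))"
    using UN a b by (intro sum.cong) (auto simp: scalar_prod_def atLeast0LessThan)
  also have "\<dots> = (\<Sum>r<N. \<Sum>k<N. \<Sum>l<N. a $ k * cnj (b $ l) * (U $$ (r, k) * cnj (U $$ (r, l))))"
    by (simp add: sum_product mult_ac)
  also have "\<dots> = (\<Sum>k<N. \<Sum>l<N. \<Sum>r<N. a $ k * cnj (b $ l) * (U $$ (r, k) * cnj (U $$ (r, l))))"
    by (subst sum.swap, rule sum.cong[OF refl], subst sum.swap) simp
  also have "\<dots> = (\<Sum>k<N. \<Sum>l<N. a $ k * cnj (b $ l) * of_bool (l = k))"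
    by (intro sum.cong refl) (simp add: sum_distrib_left[symmetric] orth)
  also have "\<dots> = (\<Sum>k<N. a $ k * cnj (b $ k))"
    by (intro sum.cong refl) (simp add: of_bool_def if_distrib[of "\<lambda>x. _ * x"] cong: if_cong)
  also have "\<dots> = a \<bullet>c b"
    by (rule cscalar_prod_conv_sum[symmetric]) (use b in simp)
  finally show ?thesis .
qed

lemma oracle_mat_carrier: "oracle_mat n d x \<in> carrier_mat (2 * n * d) (2 * n * d)"
  by (simp add: oracle_mat_def)

lemma oracle_mat_entry:
  assumes "i < n" "w < d" "c < 2 * n * d"
  shows "oracle_mat n d x $$ (basis_index d i z w, c) = of_bool (c = basis_index d i (z \<noteq> x ! i) w)"
proof -
  have "(\<exists>i'<n. \<exists>z'. \<exists>w'<d. c = basis_index d i' z' w'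
      \<and> basis_index d i z w = basis_index d i' (z' \<noteq> x ! i') w')
    \<longleftrightarrow> c = basis_index d i (z \<noteq> x ! i) w"
  proof
    assume "c = basis_index d i (z \<noteq> x ! i) w"
    \<comment> \<open>Exclusive or with \<open>x ! i\<close> is its own inverse.\<close>
    moreover have "basis_index d i z w = basis_index d i ((z \<noteq> x ! i) \<noteq> x ! i) w"
      by (cases z; cases "x ! i") simp_all
    ultimately show "\<exists>i'<n. \<exists>z'. \<exists>w'<d. c = basis_index d i' z' w'
        \<and> basis_index d i z w = basis_index d i' (z' \<noteq> x ! i') w'"
      using assms(1,2) by blast
  next
    assume "\<exists>i'<n. \<exists>z'. \<exists>w'<d. c = basis_index d i' z' w'
        \<and> basis_index d i z w = basis_index d i' (z' \<noteq> x ! i') w'"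
    then obtain i' z' w' where c: "w' < d" "c = basis_index d i' z' w'"
      and eq: "basis_index d i z w = basis_index d i' (z' \<noteq> x ! i') w'"
      by blast
    have iw: "i' = i" "w' = w" and z: "z = (z' \<noteq> x ! i')"
      using eq basis_index_eq_iff[OF assms(2) c(1)] by simp_all
    have "z' = (z \<noteq> x ! i)" unfolding z iw by (cases z'; cases "x ! i") simp_all
    with c(2) iw show "c = basis_index d i (z \<noteq> x ! i) w" by (simp only:)
  qed
  then show ?thesis
    using assms basis_index_less[of i n w d z] by (simp add: oracle_mat_def)
qed

lemma oracle_mat_mult_vec_index:
  assumes "i < n" "w < d" "v \<in> carrier_vec (2 * n * d)"
  shows "(oracle_mat n d x *\<^sub>v v) $ basis_index d i z w = v $ basis_index d i (z \<noteq> x ! i) w"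
proof -
  have "(oracle_mat n d x *\<^sub>v v) $ basis_index d i z w
      = (\<Sum>c<2 * n * d. oracle_mat n d x $$ (basis_index d i z w, c) * v $ c)"
    using assms basis_index_less[of i n w d z] oracle_mat_carrier[of n d x]
    by (simp add: scalar_prod_def atLeast0LessThan)
  also have "\<dots> = (\<Sum>c<2 * n * d. if c = basis_index d i (z \<noteq> x ! i) w then v $ c else 0)"
    using assms by (intro sum.cong) (auto simp: oracle_mat_entry)
  also have "\<dots> = v $ basis_index d i (z \<noteq> x ! i) w"
    using assms basis_index_less by (simp add: sum.delta)
  finally show ?thesis .
qed

text \<open>The inner product of the parts of two states that query position \<open>i\<close>; its diagonal
  value is the query weight of a state at \<open>i\<close>.\<close>

definition position_inner :: "nat \<Rightarrow> nat \<Rightarrow> complex vec \<Rightarrow> complex vec \<Rightarrow> real" where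
  "position_inner d i a b =
     (\<Sum>z\<in>UNIV. \<Sum>w<d. Re (a $ basis_index d i z w * cnj (b $ basis_index d i z w)))"

lemma Re_cscalar_prod_conv_position_inner:
  assumes "b \<in> carrier_vec (2 * n * d)"
  shows "Re (a \<bullet>c b) = (\<Sum>i<n. position_inner d i a b)"
  using assms cscalar_prod_conv_sum[of b "2 * n * d" a]
  by (simp add: sum_basis_index position_inner_def)

lemma position_inner_self_nonneg: "position_inner d i a a \<ge> 0"
  unfolding position_inner_def by (intro sum_nonneg) simp

text \<open>Cauchy-Schwarz with the arithmetic mean in place of the geometric one, entry by entry: a
  bound that is linear in the query weights can be summed over edges.\<close>

lemma abs_position_inner_le:
  "\<bar>position_inner d i a b\<bar> \<le> (position_inner d i a a + position_inner d i b b) / 2"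
proof -
  have *: "\<bar>Re (u * cnj v)\<bar> \<le> (Re (u * cnj u) + Re (v * cnj v)) / 2" for u v
  proof -
    have "2 * cmod u * cmod v \<le> (cmod u)\<^sup>2 + (cmod v)\<^sup>2"
      by (rule sum_squares_bound)
    moreover have "Re (t * cnj t) = (cmod t)\<^sup>2" for t
      by (simp only: complex_norm_square[symmetric] Re_complex_of_real)
    moreover have "\<bar>Re (u * cnj v)\<bar> \<le> cmod u * cmod v"
      using abs_Re_le_cmod[of "u * cnj v"] by (simp add: norm_mult)
    ultimately show ?thesis by (simp del: complex_mult_cnj)
  qed
  have "\<bar>position_inner d i a b\<bar> \<le> (\<Sum>z\<in>UNIV. \<Sum>w<d. \<bar>Re (a $ basis_index d i z w * cnj (b $ basis_index d i z w))\<bar>)"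
    unfolding position_inner_def by (intro order.trans[OF sum_abs] sum_mono sum_abs)
  also have "\<dots> \<le> (\<Sum>z\<in>UNIV. \<Sum>w<d. (Re (a $ basis_index d i z w * cnj (a $ basis_index d i z w)) +
      Re (b $ basis_index d i z w * cnj (b $ basis_index d i z w))) / 2)"
    by (intro sum_mono *)
  also have "\<dots> = (position_inner d i a a + position_inner d i b b) / 2"
    by (simp only: position_inner_def sum_divide_distrib[symmetric] sum.distrib)
  finally show ?thesis .
qed

text \<open>The oracle either fixes the block of position \<open>i\<close> in both states or
  exchanges its two halves \<open>z\<close> in both, which only permutes the summands.\<close>

lemma position_inner_oracle_mat:
  assumes "i < n" "a \<in> carrier_vec (2 * n * d)" "b \<in> carrier_vec (2 * n * d)" "x ! i = y ! i"
  shows "position_inner d i (oracle_mat n d x *\<^sub>v a) (oracle_mat n d y *\<^sub>v b) = position_inner d i a b"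
  using assms by (cases "y ! i") (simp_all add: position_inner_def oracle_mat_mult_vec_index UNIV_bool)

lemma oracle_mat_norm:
  assumes "a \<in> carrier_vec (2 * n * d)"
  shows "Re ((oracle_mat n d x *\<^sub>v a) \<bullet>c (oracle_mat n d x *\<^sub>v a)) = Re (a \<bullet>c a)"
proof -
  have "oracle_mat n d x *\<^sub>v a \<in> carrier_vec (2 * n * d)"
    using assms oracle_mat_carrier by (rule mult_mat_vec_carrier[rotated])
  then show ?thesis
    using assms by (simp only: Re_cscalar_prod_conv_position_inner) (simp add: position_inner_oracle_mat)
qed

text \<open>Only the block of position \<open>k\<close> can change. Before and after the query its
  inner product is at most the mean of the two query weights in absolute value, and the query
  preserves these weights; so the change is at most twice the mean.\<close>

lemma oracle_mat_inner_decrease: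
  assumes a: "a \<in> carrier_vec (2 * n * d)" and b: "b \<in> carrier_vec (2 * n * d)" and k: "k < n"
    and eq: "\<And>i. i < n \<Longrightarrow> i \<noteq> k \<Longrightarrow> x ! i = y ! i"
  shows "Re (a \<bullet>c b) - Re ((oracle_mat n d x *\<^sub>v a) \<bullet>c (oracle_mat n d y *\<^sub>v b))
    \<le> position_inner d k a a + position_inner d k b b"
proof -
  let ?a = "oracle_mat n d x *\<^sub>v a" and ?b = "oracle_mat n d y *\<^sub>v b"
  have b': "?b \<in> carrier_vec (2 * n * d)"
    using b oracle_mat_carrier by (rule mult_mat_vec_carrier[rotated])
  have "Re (a \<bullet>c b) - Re (?a \<bullet>c ?b) = (\<Sum>i<n. position_inner d i a b - position_inner d i ?a ?b)"
    by (simp add: Re_cscalar_prod_conv_position_inner[OF b] Re_cscalar_prod_conv_position_inner[OF b'] sum_subtractf)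
  also have "\<dots> = (\<Sum>i<n. if i = k then position_inner d k a b - position_inner d k ?a ?b else 0)"
    using eq by (intro sum.cong) (auto simp: position_inner_oracle_mat a b)
  also have "\<dots> = position_inner d k a b - position_inner d k ?a ?b"
    using k by simp
  also have "\<dots> \<le> position_inner d k a a + position_inner d k b b"
    using abs_position_inner_le[of d k a b] abs_position_inner_le[of d k ?a ?b] k
    by (simp add: position_inner_oracle_mat a b)
  finally show ?thesis .
qed

section \<open>States of a query algorithm and their distinguishability\<close>

lemma unitary_mat_mult_vec_carrier: "unitary_mat N A \<Longrightarrow> A *\<^sub>v v \<in> carrier_vec N"
  unfolding unitary_mat_def by (blast intro: carrier_vecI[OF trans[OF dim_mult_mat_vec]] dest: carrier_matD(1))

lemma query_state_carrier:
  assumes "unitary_mat (2 * n * d) (U t)"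
  shows "query_state n d U x t \<in> carrier_vec (2 * n * d)"
  using assms by (cases t) (simp_all only: query_state.simps unitary_mat_mult_vec_carrier)

lemma query_state_norm:
  assumes U: "\<And>t. t \<le> T \<Longrightarrow> unitary_mat (2 * n * d) (U t)" and nd: "n > 0" "d > 0"
  shows "t \<le> T \<Longrightarrow> Re (query_state n d U x t \<bullet>c query_state n d U x t) = 1"
proof (induction t)
  case 0
  have "basis_index d 0 False 0 < 2 * n * d"
    using nd by (intro basis_index_less)
  then have "(unit_vec (2 * n * d) (basis_index d 0 False 0) :: complex vec) \<bullet>c
      unit_vec (2 * n * d) (basis_index d 0 False 0) = 1"
    by (subst cscalar_prod_conv_sum[of _ "2 * n * d"])
       (simp_all add: unit_vec_def if_distrib[of cnj] if_distrib[of "\<lambda>x. x * _"] cong: if_cong)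
  then show ?case
    using U[of 0] by (simp add: unitary_mat_cscalar_prod)
next
  case (Suc t)
  have c: "query_state n d U x t \<in> carrier_vec (2 * n * d)"
    using Suc.prems by (intro query_state_carrier U) simp
  then have "oracle_mat n d x *\<^sub>v query_state n d U x t \<in> carrier_vec (2 * n * d)"
    using oracle_mat_carrier by (rule mult_mat_vec_carrier[rotated])
  then show ?case
    using U[of "Suc t"] Suc by (simp add: unitary_mat_cscalar_prod oracle_mat_norm[OF c])
qed

text \<open>The weights $1/3$ and $3/4$ below satisfy $4 \cdot \frac13 \cdot \frac34 = 1$, so they are
  admissible in $|uv| \le \alpha |u|^2 + \beta |v|^2$, and they are close to the optimal ratio for
  success probability $2/3$.\<close>

lemma Re_cscalar_prod_le_of_distinguished:
  fixes a b :: "complex vec"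
  assumes b: "b \<in> carrier_vec N" and a: "a \<in> carrier_vec N"
    and na: "Re (a \<bullet>c a) = 1" and nb: "Re (b \<bullet>c b) = 1"
    and pa: "(\<Sum>j | j < N \<and> out j = True. (cmod (a $ j))\<^sup>2) \<ge> 2/3"
    and pb: "(\<Sum>j | j < N \<and> out j = False. (cmod (b $ j))\<^sup>2) \<ge> 2/3"
  shows "Re (a \<bullet>c b) \<le> 17/18"
proof -
  let ?P = "{j. j < N \<and> out j = True}" and ?Q = "{j. j < N \<and> out j = False}"
  have split: "(\<Sum>j<N. f j) = sum f ?P + sum f ?Q" for f :: "nat \<Rightarrow> real"
  proof -
    have "{..<N} = ?P \<union> ?Q" by auto
    then have "sum f {..<N} = sum f (?P \<union> ?Q)" by simp
    also have "\<dots> = sum f ?P + sum f ?Q"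
      by (intro sum.union_disjoint) auto
    finally show ?thesis .
  qed
  have sq: "Re (v \<bullet>c v) = (\<Sum>j<N. (cmod (v $ j))\<^sup>2)" if "v \<in> carrier_vec N" for v
  proof -
    have "Re (v \<bullet>c v) = (\<Sum>j<N. Re (v $ j * cnj (v $ j)))"
      using that by (subst cscalar_prod_conv_sum[of v N]) auto
    also have "\<dots> = (\<Sum>j<N. (cmod (v $ j))\<^sup>2)"
      by (simp only: complex_norm_square[symmetric] Re_complex_of_real)
    finally show ?thesis .
  qed
  have 1: "Re (u * cnj v) \<le> (cmod u)\<^sup>2 / 3 + 3 * (cmod v)\<^sup>2 / 4" for u v
  proof -
    have "(2 * cmod u - 3 * cmod v)\<^sup>2 \<ge> 0" by simp
    then have "cmod u * cmod v \<le> (cmod u)\<^sup>2 / 3 + 3 * (cmod v)\<^sup>2 / 4"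
      by (simp add: power2_eq_square algebra_simps)
    then show ?thesis
      using complex_Re_le_cmod[of "u * cnj v"] by (simp add: norm_mult)
  qed
  have 2: "Re (u * cnj v) \<le> 3 * (cmod u)\<^sup>2 / 4 + (cmod v)\<^sup>2 / 3" for u v
    using 1[of v u] by (simp add: mult.commute)
  have "Re (a \<bullet>c b) = (\<Sum>j<N. Re (a $ j * cnj (b $ j)))"
    using b by (subst cscalar_prod_conv_sum[of b N]) auto
  \<comment> \<open>On \<open>?P\<close> most of the mass belongs to \<open>a\<close>, on
    \<open>?Q\<close> to \<open>b\<close>; the smaller weight 1/3 goes with the larger mass.\<close>
  also have "\<dots> \<le> (\<Sum>j\<in>?P. (cmod (a $ j))\<^sup>2 / 3 + 3 * (cmod (b $ j))\<^sup>2 / 4)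
      + (\<Sum>j\<in>?Q. 3 * (cmod (a $ j))\<^sup>2 / 4 + (cmod (b $ j))\<^sup>2 / 3)"
    unfolding split by (intro add_mono sum_mono 1 2)
  also have "\<dots> = (\<Sum>j\<in>?P. (cmod (a $ j))\<^sup>2) / 3 + 3 * (\<Sum>j\<in>?P. (cmod (b $ j))\<^sup>2) / 4
      + 3 * (\<Sum>j\<in>?Q. (cmod (a $ j))\<^sup>2) / 4 + (\<Sum>j\<in>?Q. (cmod (b $ j))\<^sup>2) / 3"
    by (simp only: sum.distrib sum_divide_distrib sum_distrib_left add.assoc)
  \<comment> \<open>If \<open>a\<close> has mass A on \<open>?P\<close> and \<open>b\<close> has
    mass B on \<open>?Q\<close>, the sum is 3/2 - 5(A + B)/12, and both A and B are at least
    2/3.\<close>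
  also have "\<dots> \<le> 17/18"
    using na nb pa pb unfolding sq[OF a] sq[OF b] split by simp
  finally show ?thesis .
qed

subsection \<open>The adversary bound\<close>

definition flip :: "nat \<Rightarrow> bool list \<Rightarrow> bool list" where
  "flip i x = x[i := \<not> x ! i]"

lemma flip_flip [simp]: "flip i (flip i x) = x"
  by (cases "i < length x") (simp_all add: flip_def list_update_beyond)

lemma length_flip [simp]: "length (flip i x) = length x"
  by (simp add: flip_def)

text \<open>The sets \<open>X\<close> and \<open>Y\<close> are the sides of a graph whose edges are
  single-bit flips, and \<open>s\<close> bounds all degrees from below. The constant is 2 * 18: an
  edge loses at least 1/18 of its inner product, and \<open>s\<close> times the number of vertices
  is at most twice the number of edges.\<close>

lemma adversary_lower_bound:
  assumes comp: "computable_with_queries n g T" and n: "n > 0"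
    and X: "X \<noteq> {}" "\<And>x. x \<in> X \<Longrightarrow> length x = n \<and> g x"
    and Y: "\<And>y. y \<in> Y \<Longrightarrow> length y = n \<and> \<not> g y"
    and sX: "\<And>x. x \<in> X \<Longrightarrow> s \<le> card {i. i < n \<and> flip i x \<in> Y}"
    and sY: "\<And>y. y \<in> Y \<Longrightarrow> s \<le> card {i. i < n \<and> flip i y \<in> X}"
  shows "s \<le> 36 * T"
proof -
  obtain d U out where d: "d > 0" and U: "\<And>t. t \<le> T \<Longrightarrow> unitary_mat (2 * n * d) (U t)"
    and P: "\<And>x. length x = n \<Longrightarrow> output_prob n d U out T x (g x) \<ge> 2/3"
    using comp by (auto simp: computable_with_queries_def)
  define \<psi> where "\<psi> = query_state n d U"
  have carr: "\<psi> x t \<in> carrier_vec (2 * n * d)" if "t \<le> T" for x t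
    unfolding \<psi>_def using U[OF that] by (rule query_state_carrier)
  have norm: "Re (\<psi> x t \<bullet>c \<psi> x t) = 1" if "t \<le> T" for x t
    unfolding \<psi>_def using U n d that by (rule query_state_norm)
  have "finite {xs :: bool list. set xs \<subseteq> UNIV \<and> length xs = n}"
    by (rule finite_lists_length_eq) simp
  then have fin: "finite X" "finite Y"
    using X Y by (auto elim!: rev_finite_subset)
  \<comment> \<open>An edge is stored as an endpoint with the flipped position, seen from
    \<open>X\<close> in \<open>R\<close> and from \<open>Y\<close> in \<open>R'\<close>.\<close>
  define R where "R = (SIGMA x:X. {i. i < n \<and> flip i x \<in> Y})"
  define R' where "R' = (SIGMA y:Y. {i. i < n \<and> flip i y \<in> X})"
  have finR: "finite R" unfolding R_def using fin by (intro finite_SigmaI) auto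
  have bij: "bij_betw (\<lambda>(x, i). (flip i x, i)) R R'"
    by (rule bij_betw_byWitness[where f' = "\<lambda>(x, i). (flip i x, i)"]) (auto simp: R_def R'_def)
  have cX: "s * card X \<le> card R"
    using sum_mono[OF sX, of X] fin by (simp add: R_def mult.commute)
  have cY: "s * card Y \<le> card R"
    using sum_mono[OF sY, of Y] fin bij_betw_same_card[OF bij] by (simp add: R'_def mult.commute)
  \<comment> \<open>The progress measure: every edge starts at inner product 1 and must end at 17/18
    or less.\<close>
  define W where "W t = (\<Sum>(x, i)\<in>R. Re (\<psi> x t \<bullet>c \<psi> (flip i x) t))" for t
  have weight: "(\<Sum>i<n. position_inner d i (\<psi> x t) (\<psi> x t)) = 1" if "t \<le> T" for x t
    using norm[OF that] Re_cscalar_prod_conv_position_inner[OF carr[OF that]] by metis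
  \<comment> \<open>The edges at one vertex belong to distinct positions, so their query weights add
    up to at most the squared norm 1 of the state.\<close>
  have mass: "(\<Sum>(x, i)\<in>(SIGMA x:Z. {i. i < n \<and> Q i x}). position_inner d i (\<psi> x t) (\<psi> x t)) \<le> card Z"
    if t: "t \<le> T" and "finite Z" for Z Q t
  proof -
    have "(\<Sum>(x, i)\<in>(SIGMA x:Z. {i. i < n \<and> Q i x}). position_inner d i (\<psi> x t) (\<psi> x t))
        = (\<Sum>x\<in>Z. \<Sum>i | i < n \<and> Q i x. position_inner d i (\<psi> x t) (\<psi> x t))"
      using that by (subst sum.Sigma) auto
    also have "\<dots> \<le> (\<Sum>x\<in>Z. \<Sum>i<n. position_inner d i (\<psi> x t) (\<psi> x t))"
      by (intro sum_mono sum_mono2) (auto simp: position_inner_self_nonneg)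
    also have "\<dots> = card Z"
      by (simp add: weight[OF t])
    finally show ?thesis .
  qed
  have step: "W t - W (Suc t) \<le> card X + card Y" if t: "Suc t \<le> T" for t
  proof -
    have t': "t \<le> T" using t by simp
    have "W t - W (Suc t)
        = (\<Sum>(x, i)\<in>R. Re (\<psi> x t \<bullet>c \<psi> (flip i x) t) - Re (\<psi> x (Suc t) \<bullet>c \<psi> (flip i x) (Suc t)))"
      by (simp add: W_def sum_subtractf split_def)
    also have "\<dots> \<le> (\<Sum>(x, i)\<in>R. position_inner d i (\<psi> x t) (\<psi> x t)
        + position_inner d i (\<psi> (flip i x) t) (\<psi> (flip i x) t))"
    proof (rule sum_mono, clarify)
      fix x i assume xi: "(x, i) \<in> R"
      let ?y = "flip i x"
      have o: "oracle_mat n d z *\<^sub>v \<psi> z t \<in> carrier_vec (2 * n * d)" for z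
        using carr[OF t'] oracle_mat_carrier by (rule mult_mat_vec_carrier[rotated])
      \<comment> \<open>\<open>U (Suc t)\<close> is the same for both inputs and cancels; only the
        two oracles differ.\<close>
      have "\<psi> x (Suc t) \<bullet>c \<psi> ?y (Suc t)
          = (oracle_mat n d x *\<^sub>v \<psi> x t) \<bullet>c (oracle_mat n d ?y *\<^sub>v \<psi> ?y t)"
        using unitary_mat_cscalar_prod[OF U[OF t] o o] by (simp add: \<psi>_def)
      moreover have "Re (\<psi> x t \<bullet>c \<psi> ?y t)
          - Re ((oracle_mat n d x *\<^sub>v \<psi> x t) \<bullet>c (oracle_mat n d ?y *\<^sub>v \<psi> ?y t))
          \<le> position_inner d i (\<psi> x t) (\<psi> x t) + position_inner d i (\<psi> ?y t) (\<psi> ?y t)"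
        using xi by (intro oracle_mat_inner_decrease carr t') (auto simp: R_def flip_def)
      ultimately show "Re (\<psi> x t \<bullet>c \<psi> ?y t) - Re (\<psi> x (Suc t) \<bullet>c \<psi> ?y (Suc t))
          \<le> position_inner d i (\<psi> x t) (\<psi> x t) + position_inner d i (\<psi> ?y t) (\<psi> ?y t)"
        by simp
    qed
    also have "\<dots> = (\<Sum>(x, i)\<in>R. position_inner d i (\<psi> x t) (\<psi> x t))
        + (\<Sum>(y, i)\<in>R'. position_inner d i (\<psi> y t) (\<psi> y t))"
      by (simp add: sum.reindex_bij_betw[OF bij, symmetric] split_def sum.distrib)
    also have "\<dots> \<le> card X + card Y"
      unfolding R_def R'_def of_nat_add by (intro add_mono mass t' fin)
    finally show ?thesis .
  qed
  have "W 0 - W t \<le> t * (card X + card Y)" if "t \<le> T" for t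
    using that
  proof (induction t)
    case (Suc t)
    then show ?case using step[of t] by (simp add: algebra_simps)
  qed simp
  from this[of T] have total: "W 0 - W T \<le> T * (card X + card Y)" by simp
  \<comment> \<open>Before any query the state does not depend on the input.\<close>
  have "W 0 = (\<Sum>(x, i)\<in>R. 1)"
    unfolding W_def using norm[of 0] by (intro sum.cong) (auto simp: \<psi>_def)
  then have W0: "W 0 = card R" by (simp add: split_def)
  have "W T \<le> (\<Sum>(x, i)\<in>R. 17/18)"
    unfolding W_def
  proof (rule sum_mono, clarify)
    fix x i assume "(x, i) \<in> R"
    then have x: "x \<in> X" and y: "flip i x \<in> Y" by (auto simp: R_def)
    show "Re (\<psi> x T \<bullet>c \<psi> (flip i x) T) \<le> 17/18"
      by (rule Re_cscalar_prod_le_of_distinguished[OF carr carr norm norm, where out = out])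
        (use P[of x] P[of "flip i x"] X(2)[OF x] Y[OF y] in \<open>auto simp: output_prob_def \<psi>_def\<close>)
  qed
  then have WT: "W T \<le> 17/18 * card R" by (simp add: split_def)
  have "real (card R) \<le> 18 * T * (card X + card Y)"
    using total W0 WT by (simp add: algebra_simps)
  then have R: "card R \<le> 18 * T * (card X + card Y)"
    by (metis of_nat_le_iff of_nat_mult of_nat_numeral)
  \<comment> \<open>Multiplication by \<open>s\<close> lets \<open>cX\<close> and \<open>cY\<close>
    replace the vertex counts by \<open>card R\<close>, which is then cancelled.\<close>
  have "s * card R \<le> 18 * T * (s * card X + s * card Y)"
    using mult_left_mono[OF R, of s] by (simp add: algebra_simps)
  also have "\<dots> \<le> 18 * T * (card R + card R)"
    by (intro mult_left_mono add_mono cX cY) simp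
  also have "\<dots> = 36 * T * card R" by simp
  finally have sR: "s * card R \<le> 36 * T * card R" .
  show ?thesis
  proof (cases "card R = 0")
    \<comment> \<open>Without edges, \<open>cX\<close> and the nonempty \<open>X\<close> force
      \<open>s = 0\<close>.\<close>
    case True
    then have "s = 0" using cX X fin by simp
    then show ?thesis by simp
  next
    case False
    then show ?thesis using sR by simp
  qed
qed

subsection \<open>Reading the whole input\<close>

text \<open>The images of \<open>A\<close> under \<open>f\<close> and \<open>g\<close> have equal
  size, hence so do their complements in \<open>S\<close>, which can be matched arbitrarily. This
  completes a partial prescription on basis states to a permutation, and so to a unitary
  map.\<close>

lemma bij_betw_extension:
  assumes S: "finite S" and f: "inj_on f A" "f ` A \<subseteq> S" and g: "inj_on g A" "g ` A \<subseteq> S"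
  shows "\<exists>\<pi>. bij_betw \<pi> S S \<and> (\<forall>a\<in>A. \<pi> (f a) = g a)"
proof -
  have "card (f ` A) = card (g ` A)"
    using f g by (simp add: card_image)
  then have "card (S - f ` A) = card (S - g ` A)"
    using S by (simp add: card_Diff_subset f(2) g(2) finite_subset[OF f(2)] finite_subset[OF g(2)])
  then obtain h where h: "bij_betw h (S - f ` A) (S - g ` A)"
    using finite_same_card_bij[OF finite_Diff[OF S] finite_Diff[OF S]] by blast
  define \<pi> where "\<pi> = (\<lambda>s. if s \<in> f ` A then g (inv_into A f s) else h s)"
  have \<pi>f: "\<pi> (f a) = g a" if "a \<in> A" for a
    using f that by (simp add: \<pi>_def)
  have "inj_on \<pi> (f ` A)"
    using g by (auto simp: inj_on_def \<pi>f)
  then have "bij_betw \<pi> (f ` A) (g ` A)"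
    by (simp add: bij_betw_def image_image \<pi>f)
  moreover have "bij_betw \<pi> (S - f ` A) (S - g ` A)"
    using h by (rule bij_betw_cong[THEN iffD2, rotated]) (simp add: \<pi>_def)
  ultimately have "bij_betw \<pi> (f ` A \<union> (S - f ` A)) (g ` A \<union> (S - g ` A))"
    by (rule bij_betw_combine) auto
  moreover have "f ` A \<union> (S - f ` A) = S" "g ` A \<union> (S - g ` A) = S"
    using f g by auto
  ultimately show ?thesis using \<pi>f by auto
qed

definition perm_mat :: "nat \<Rightarrow> (nat \<Rightarrow> nat) \<Rightarrow> complex mat" where
  "perm_mat N \<pi> = mat N N (\<lambda>(r, c). of_bool (r = \<pi> c))"

lemma unitary_mat_perm_mat:
  assumes \<pi>: "bij_betw \<pi> {..<N} {..<N}"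
  shows "unitary_mat N (perm_mat N \<pi>)"
proof -
  let ?P = "perm_mat N \<pi>"
  have adj: "mat_adjoint ?P = mat N N (\<lambda>(r, c). of_bool (c = \<pi> r))"
    unfolding perm_mat_def mat_adjoint_def by (rule eq_matI) (auto simp: mat_of_rows_def)
  have dim: "dim_row ?P = N" "dim_col ?P = N"
    by (simp_all add: perm_mat_def)
  have lt: "\<pi> c < N" if "c < N" for c
    using \<pi> that by (auto simp: bij_betw_def)
  have eq: "\<pi> i = \<pi> j \<longleftrightarrow> i = j" if "i < N" "j < N" for i j
    using \<pi> that by (auto simp: bij_betw_def inj_on_def)
  have "mat_adjoint ?P * ?P = 1\<^sub>m N"
  proof (rule eq_matI)
    fix i j assume "i < dim_row (1\<^sub>m N :: complex mat)" "j < dim_col (1\<^sub>m N :: complex mat)"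
    then have ij: "i < N" "j < N" by simp_all
    have "(mat_adjoint ?P * ?P) $$ (i, j) = (\<Sum>r<N. of_bool (r = \<pi> i) * of_bool (r = \<pi> j))"
      using ij unfolding adj by (simp add: perm_mat_def scalar_prod_def atLeast0LessThan)
    also have "\<dots> = (\<Sum>r<N. if r = \<pi> i then of_bool (\<pi> i = \<pi> j) else 0)"
      by (intro sum.cong) auto
    also have "\<dots> = 1\<^sub>m N $$ (i, j)"
      using ij lt by (simp add: eq)
    finally show "(mat_adjoint ?P * ?P) $$ (i, j) = 1\<^sub>m N $$ (i, j)" .
  qed (simp_all add: adj dim)
  moreover have "?P * mat_adjoint ?P = 1\<^sub>m N"
  proof (rule eq_matI)
    fix i j assume "i < dim_row (1\<^sub>m N :: complex mat)" "j < dim_col (1\<^sub>m N :: complex mat)"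
    then have ij: "i < N" "j < N" by simp_all
    have "(?P * mat_adjoint ?P) $$ (i, j) = (\<Sum>c<N. of_bool (i = \<pi> c) * of_bool (j = \<pi> c))"
      using ij unfolding adj by (simp add: perm_mat_def scalar_prod_def atLeast0LessThan)
    also have "\<dots> = (\<Sum>r<N. of_bool (i = r) * of_bool (j = r))"
      by (rule sum.reindex_bij_betw[OF \<pi>])
    also have "\<dots> = (\<Sum>r<N. if r = i then of_bool (i = j) else 0)"
      by (intro sum.cong) auto
    also have "\<dots> = 1\<^sub>m N $$ (i, j)"
      using ij by simp
    finally show "(?P * mat_adjoint ?P) $$ (i, j) = 1\<^sub>m N $$ (i, j)" .
  qed (simp_all add: adj dim)
  ultimately show ?thesis
    by (simp add: unitary_mat_def) (simp add: perm_mat_def)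
qed

lemma perm_mat_mult_unit_vec:
  assumes "c < N"
  shows "perm_mat N \<pi> *\<^sub>v unit_vec N c = unit_vec N (\<pi> c)"
proof (rule eq_vecI)
  fix r assume "r < dim_vec (unit_vec N (\<pi> c) :: complex vec)"
  then show "(perm_mat N \<pi> *\<^sub>v unit_vec N c) $ r = unit_vec N (\<pi> c) $ r"
    using assms by (simp add: perm_mat_def) (simp add: unit_vec_def)
qed (simp add: perm_mat_def)

lemma oracle_mat_mult_unit_vec:
  assumes "i < n" "w < d"
  shows "oracle_mat n d x *\<^sub>v unit_vec (2 * n * d) (basis_index d i z w)
    = unit_vec (2 * n * d) (basis_index d i (z \<noteq> x ! i) w)"
proof (rule eq_vecI)
  fix r assume "r < dim_vec (unit_vec (2 * n * d) (basis_index d i (z \<noteq> x ! i) w) :: complex vec)"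
  then have "r < 2 * n * d" by simp
  then obtain i' z' w' where r: "i' < n" "w' < d" "r = basis_index d i' z' w'"
    by (rule basis_index_cases)
  have "(z' \<noteq> x ! i) = z \<longleftrightarrow> z' = (z \<noteq> x ! i)" by auto
  then show "(oracle_mat n d x *\<^sub>v unit_vec (2 * n * d) (basis_index d i z w)) $ r
      = unit_vec (2 * n * d) (basis_index d i (z \<noteq> x ! i) w) $ r"
    using r assms basis_index_less
    by (simp add: oracle_mat_mult_vec_index index_unit_vec basis_index_eq_iff) auto
qed (simp add: oracle_mat_def)

text \<open>Every function is computed with certainty once all bits are read. This makes the set
  under \<open>LEAST\<close> nonempty, so that the minimum is attained.\<close>

lemma computable_with_queries_exists:
  assumes n: "n > 0"
  shows "computable_with_queries n g n"
proof -
  let ?L = "{x :: bool list. length x \<le> n}"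
  have "finite {xs :: bool list. set xs \<subseteq> UNIV \<and> length xs \<le> n}"
    by (rule finite_lists_length_le) simp
  then have finL: "finite ?L" by simp
  define d where "d = card ?L"
  obtain code where code: "bij_betw code ?L {..<d}"
    using ex_bij_betw_finite_nat[OF finL] by (auto simp: d_def atLeast0LessThan)
  have code_less: "code x < d" if "length x \<le> n" for x
    using code that by (auto simp: bij_betw_def)
  have code_eq: "code x = code y \<longleftrightarrow> x = y" if "length x \<le> n" "length y \<le> n" for x y
    using code that by (auto simp: bij_betw_def inj_on_def)
  have d: "d > 0" using code_less[of "[]"] by simp
  let ?N = "2 * n * d"
  \<comment> \<open>Query the positions in order and record the answers in the workspace. The requirement on \<open>U t\<close>
    is only on the basis states reached after \<open>t\<close> queries, so any permutation of the basis that
    extends it will do. After the last query the position register is parked at \<open>0\<close>.\<close>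
  define before where "before = (\<lambda>y. if y = [] then basis_index d 0 False 0
    else basis_index d (length y - 1) (last y) (code (butlast y)))"
  define after where "after = (\<lambda>y. basis_index d (if length y < n then length y else 0) False (code y))"
  have ex: "\<exists>\<pi>. bij_betw \<pi> {..<?N} {..<?N} \<and> (\<forall>y\<in>{y. length y = t}. \<pi> (before y) = after y)"
    if t: "t \<le> n" for t
  proof (rule bij_betw_extension)
    show "inj_on before {y. length y = t}"
    proof (rule inj_onI)
      fix x y assume x: "x \<in> {y. length y = t}" and y: "y \<in> {y. length y = t}" and eq: "before x = before y"
      show "x = y"
      proof (cases t)
        case 0
        then show ?thesis using x y by simp
      next
        case (Suc t')
        have ne: "x \<noteq> []" "y \<noteq> []" using x y Suc by auto
        have "code (butlast x) < d" "code (butlast y) < d"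
          using x y t by (auto intro: code_less)
        then have "last x = last y" "code (butlast x) = code (butlast y)"
          using eq ne by (auto simp: before_def basis_index_eq_iff)
        then have "last x = last y" "butlast x = butlast y"
          using x y t by (auto simp: code_eq)
        then have "butlast x @ [last x] = butlast y @ [last y]" by simp
        then show ?thesis using ne by simp
      qed
    qed
    show "inj_on after {y. length y = t}"
      using t by (auto simp: inj_on_def after_def basis_index_eq_iff code_less code_eq)
    show "before ` {y. length y = t} \<subseteq> {..<?N}"
    proof (rule image_subsetI)
      fix y :: "bool list" assume "y \<in> {y. length y = t}"
      then have y: "length y = t" by simp
      have "code (butlast y) < d" using y t by (intro code_less) simp
      moreover have "length y - 1 < n" using y t n by simp
      ultimately show "before y \<in> {..<?N}"
        using n d by (simp add: before_def basis_index_less)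
    qed
    show "after ` {y. length y = t} \<subseteq> {..<?N}"
      using t n d by (auto simp: after_def intro!: basis_index_less code_less)
  qed simp
  define \<pi> where "\<pi> t = (SOME \<pi>. bij_betw \<pi> {..<?N} {..<?N} \<and> (\<forall>y\<in>{y. length y = t}. \<pi> (before y) = after y))" for t
  have \<pi>: "bij_betw (\<pi> t) {..<?N} {..<?N}" "length y = t \<Longrightarrow> \<pi> t (before y) = after y" if "t \<le> n" for t y
    using someI_ex[OF ex[OF that]] by (auto simp: \<pi>_def)
  define U where "U t = perm_mat ?N (\<pi> t)" for t
  \<comment> \<open>\<open>after\<close> is injective on strings of length \<open>n\<close>, so the
    outcome reveals the whole input.\<close>
  define out where "out j \<longleftrightarrow> (\<exists>x. length x = n \<and> j = after x \<and> g x)" for j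
  have state: "query_state n d U x t = unit_vec ?N (after (take t x))" if x: "length x = n" and "t \<le> n" for x t
    using \<open>t \<le> n\<close>
  proof (induction t)
    case 0
    have "query_state n d U x 0 = unit_vec ?N (\<pi> 0 (before []))"
      using n d by (simp add: U_def before_def perm_mat_mult_unit_vec basis_index_less)
    then show ?case by (simp add: \<pi>)
  next
    case (Suc t)
    then have t: "t < n" by simp
    have w: "code (take t x) < d" using t by (intro code_less) simp
    have tk: "take (Suc t) x = take t x @ [x ! t]"
      using x t by (simp add: take_Suc_conv_app_nth)
    have "oracle_mat n d x *\<^sub>v query_state n d U x t
        = unit_vec ?N (basis_index d t (False \<noteq> x ! t) (code (take t x)))"
      using Suc t x w oracle_mat_mult_unit_vec[of t n _ d x False] by (simp add: after_def)
    also have "basis_index d t (False \<noteq> x ! t) (code (take t x)) = before (take (Suc t) x)"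
      using x t by (simp add: before_def tk)
    finally have "query_state n d U x (Suc t) = U (Suc t) *\<^sub>v unit_vec ?N (before (take (Suc t) x))"
      by simp
    moreover have "before (take (Suc t) x) < ?N"
      using x t w by (simp add: before_def tk basis_index_less)
    ultimately have "query_state n d U x (Suc t) = unit_vec ?N (\<pi> (Suc t) (before (take (Suc t) x)))"
      by (simp add: U_def perm_mat_mult_unit_vec)
    then show ?case using \<pi>(2)[of "Suc t" "take (Suc t) x"] x t by simp
  qed
  have "output_prob n d U out n x (g x) \<ge> 2/3" if x: "length x = n" for x
  proof -
    have lt: "after x < ?N"
      using x n by (auto simp: after_def intro!: basis_index_less code_less)
    have "y = x" if "length y = n" "after x = after y" for y
      using that x by (simp add: after_def basis_index_eq_iff code_less code_eq)
    then have "out (after x) = g x"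
      unfolding out_def using x by blast
    \<comment> \<open>The final state is a single basis vector, so this one outcome has probability
      1.\<close>
    then have "(\<Sum>j\<in>{after x}. (cmod (unit_vec ?N (after x) $ j))\<^sup>2)
        \<le> (\<Sum>j | j < ?N \<and> out j = g x. (cmod (unit_vec ?N (after x) $ j))\<^sup>2)"
      using lt by (intro sum_mono2) auto
    then show ?thesis
      using state[OF x, of n] x lt by (simp add: output_prob_def)
  qed
  moreover have "unitary_mat ?N (U t)" if "t \<le> n" for t
    using \<pi>(1)[OF that] by (simp add: U_def unitary_mat_perm_mat)
  ultimately show ?thesis
    using d unfolding computable_with_queries_def by blast
qed

lemma computable_quantum_query_complexity:
  "n > 0 \<Longrightarrow> computable_with_queries n g (quantum_query_complexity n g)"
  unfolding quantum_query_complexity_def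
  using computable_with_queries_exists by (rule LeastI)

subsection \<open>Iterated blocks of parentheses\<close>

lemma balance_Nil [simp]: "balance [] = 0"
  and balance_Cons [simp]: "balance (b # x) = (if b then balance x - 1 else balance x + 1)"
  and balance_append [simp]: "balance (x @ y) = balance x + balance y"
  by (simp_all add: balance_def)

lemma balance_replicate [simp]: "balance (replicate k b) = (if b then - int k else int k)"
  by (induction k) auto

text \<open>An element of \<open>core m l b\<close> acts like the single parenthesis \<open>b\<close>: its balance is that of
  \<open>[b]\<close>. The blocks of the next level contribute balance $0$ or $-2$, according as $m$ or $m+1$ of
  the $2m$ blocks are closing, and the additional opening parenthesis turns this into $1$ or $-1$.\<close>

fun core :: "nat \<Rightarrow> nat \<Rightarrow> bool \<Rightarrow> bool list set" where
  "core m 0 b = {[b]}"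
| "core m (Suc l) b = {concat bs @ [False] | bs ps. length ps = 2 * m \<and>
     count_list ps True = m + of_bool b \<and> list_all2 (\<lambda>y p. y \<in> core m l p) bs ps}"

fun core_length :: "nat \<Rightarrow> nat \<Rightarrow> nat" where
  "core_length m 0 = 1"
| "core_length m (Suc l) = 2 * m * core_length m l + 1"

lemma length_concat_uniform:
  "(\<And>y. y \<in> set bs \<Longrightarrow> length y = L) \<Longrightarrow> length (concat bs) = length bs * L"
  by (induction bs) auto

lemma length_core: "x \<in> core m l b \<Longrightarrow> length x = core_length m l"
proof (induction l arbitrary: x b)
  case (Suc l)
  then obtain bs ps where x: "x = concat bs @ [False]" "length ps = 2 * m"
    and all: "list_all2 (\<lambda>y p. y \<in> core m l p) bs ps" by auto
  have "length (concat bs) = length bs * core_length m l"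
    using all Suc.IH by (intro length_concat_uniform) (auto simp: list_all2_conv_all_nth in_set_conv_nth)
  then show ?case using x list_all2_lengthD[OF all] by simp
qed simp

lemma balance_concat:
  assumes "list_all2 (\<lambda>y p. balance y = (if p then -1 else 1)) bs ps"
  shows "balance (concat bs) = int (length ps) - 2 * int (count_list ps True)"
  using assms by (induction rule: list_all2_induct) auto

lemma balance_core: "x \<in> core m l b \<Longrightarrow> balance x = (if b then -1 else 1)"
proof (induction l arbitrary: x b)
  case (Suc l)
  then obtain bs ps where x: "x = concat bs @ [False]" "length ps = 2 * m"
    "count_list ps True = m + of_bool b"
    and all: "list_all2 (\<lambda>y p. y \<in> core m l p) bs ps" by auto
  have "list_all2 (\<lambda>y p. balance y = (if p then -1 else 1)) bs ps"
    using all by (rule list_all2_mono) (rule Suc.IH)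
  then show ?case using balance_concat x by simp
qed simp

text \<open>A prefix consists of complete blocks and part of one more. In whatever order they come,
  the complete blocks contribute at least minus the number of closing ones and at most the number of
  opening ones; the partial block adds at most \<open>h\<close> either way.\<close>

lemma balance_prefix_concat:
  assumes "list_all2 (\<lambda>y p. balance y = (if p then -1 else 1) \<and>
      (\<forall>q. prefix q y \<longrightarrow> \<bar>balance q\<bar> \<le> h)) bs ps"
    and "prefix q (concat bs)" and "h \<ge> 0"
  shows "- h - int (count_list ps True) \<le> balance q
    \<and> balance q \<le> h + (int (length ps) - int (count_list ps True))"
  using assms(1,2)
proof (induction arbitrary: q rule: list_all2_induct)
  case Nil
  then show ?case using \<open>h \<ge> 0\<close> by simp
next
  case (Cons y bs p ps)
  have "count_list ps True \<le> length ps" by (rule count_le_length)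
  show ?case
  proof (cases "prefix q y")
    case True
    then have "\<bar>balance q\<bar> \<le> h" using Cons.hyps by blast
    then show ?thesis using \<open>count_list ps True \<le> length ps\<close> by auto
  next
    case False
    then obtain q' where "q = y @ q'" "prefix q' (concat bs)"
      using Cons.prems by (auto simp: prefix_append)
    then show ?thesis using Cons.IH[of q'] Cons.hyps by auto
  qed
qed

lemma balance_prefix_core:
  "x \<in> core m l b \<Longrightarrow> prefix q x \<Longrightarrow> \<bar>balance q\<bar> \<le> 1 + int (l * (m + 1))"
proof (induction l arbitrary: x b q)
  case 0
  then show ?case by (auto simp: prefix_Cons)
next
  case (Suc l)
  let ?h = "1 + int (l * (m + 1))"
  from Suc obtain bs ps where x: "x = concat bs @ [False]" "length ps = 2 * m"
    "count_list ps True = m + of_bool b"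
    and all: "list_all2 (\<lambda>y p. y \<in> core m l p) bs ps" by auto
  have "list_all2 (\<lambda>y p. balance y = (if p then -1 else 1) \<and>
      (\<forall>q. prefix q y \<longrightarrow> \<bar>balance q\<bar> \<le> ?h)) bs ps"
    using all by (rule list_all2_mono) (use balance_core Suc.IH in blast)
  note bound = balance_prefix_concat[OF this]
  show ?case
  proof (cases "q = x")
    case True
    then show ?thesis using balance_core[OF Suc.prems(1)] by auto
  next
    case False
    then have "prefix q (concat bs)" using Suc.prems x by (simp add: prefix_snoc)
    \<comment> \<open>There are at most \<open>m + 1\<close> closing and at most \<open>m\<close>
      opening blocks, so a level costs at most \<open>m + 1\<close>.\<close>
    then show ?thesis using bound[of q] x by (auto simp: of_bool_def split: if_splits)
  qed
qed

lemma count_list_replicate: "count_list (replicate k b) a = (if b = a then k else 0)"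
  by (induction k) auto

lemma core_nonempty:
  assumes "m > 0"
  shows "core m l b \<noteq> {}"
proof (induction l arbitrary: b)
  case (Suc l)
  define y where "y b = (SOME x. x \<in> core m l b)" for b
  have y: "y b \<in> core m l b" for b
    unfolding y_def using Suc by (rule some_in_eq[THEN iffD2])
  \<comment> \<open>For \<open>m > 0\<close> the truncated difference is exact, so there are
    \<open>2 * m\<close> types.\<close>
  let ?ps = "replicate (m + of_bool b) True @ replicate (m - of_bool b) False"
  have "list_all2 (\<lambda>y p. y \<in> core m l p) (map y ?ps) ?ps"
    by (rule list_all2_all_nthI) (simp_all only: length_map nth_map y)
  moreover have "length ?ps = 2 * m" "count_list ?ps True = m + of_bool b"
    using assms by (simp_all add: count_list_replicate of_bool_def)
  ultimately have "concat (map y ?ps) @ [False] \<in> core m (Suc l) b"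
    unfolding core.simps by blast
  then show ?case by blast
qed simp

lemma flip_append_mid:
  "i < length y \<Longrightarrow> flip (length u + i) (u @ y @ v) = u @ flip i y @ v"
  by (simp add: flip_def nth_append list_update_append)

text \<open>The flipped block has the type \<open>b\<close> of the whole string, so the number of
  closing blocks moves between \<open>m\<close> and \<open>m + 1\<close> in the direction that
  negates \<open>b\<close>. Blocks have equal length, hence the position
  \<open>j * core_length m l + i\<close>.\<close>

lemma flip_core_block:
  assumes len: "length ps = 2 * m" and cnt: "count_list ps True = m + of_bool b"
    and all: "list_all2 (\<lambda>y p. y \<in> core m l p) bs ps"
    and j: "j < 2 * m" "ps ! j = b"
    and i: "i < length (bs ! j)" "flip i (bs ! j) \<in> core m l (\<not> b)"
  shows "j * core_length m l + i < 2 * m * core_length m l"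
    and "flip (j * core_length m l + i) (concat bs @ [False]) \<in> core m (Suc l) (\<not> b)"
proof -
  let ?L = "core_length m l"
  have lbs: "length bs = 2 * m" using list_all2_lengthD[OF all] len by simp
  have blk: "length y = ?L" if "y \<in> set bs" for y
    using that all by (auto simp: list_all2_conv_all_nth in_set_conv_nth intro: length_core)
  have iL: "i < ?L" using i blk[of "bs ! j"] j lbs by simp
  have "j * ?L + i < Suc j * ?L" using iL by simp
  also have "\<dots> \<le> 2 * m * ?L" using j by (intro mult_right_mono) auto
  finally show "j * ?L + i < 2 * m * ?L" .
  have "length (concat (take j bs)) = length (take j bs) * ?L"
    by (rule length_concat_uniform) (meson blk in_set_takeD)
  then have pos: "length (concat (take j bs)) = j * ?L" using j lbs by simp
  have "bs = take j bs @ bs ! j # drop (Suc j) bs"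
    using j lbs by (simp add: id_take_nth_drop)
  then have "concat bs @ [False]
      = concat (take j bs) @ bs ! j @ concat (drop (Suc j) bs) @ [False]"
    by (metis append.assoc concat.simps(2) concat_append)
  then have "flip (j * ?L + i) (concat bs @ [False])
      = concat (take j bs) @ flip i (bs ! j) @ concat (drop (Suc j) bs) @ [False]"
    using flip_append_mid[OF i(1), of "concat (take j bs)"] by (simp add: pos)
  also have "\<dots> = concat (bs[j := flip i (bs ! j)]) @ [False]"
    using j lbs by (simp add: upd_conv_take_nth_drop)
  finally have eq: "flip (j * ?L + i) (concat bs @ [False]) = concat (bs[j := flip i (bs ! j)]) @ [False]" .
  have "ps = take j ps @ b # drop (Suc j) ps"
    using j len id_take_nth_drop[of j ps] by simp
  then have "count_list ps True = count_list (take j ps @ b # drop (Suc j) ps) True"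
    by (rule arg_cong)
  \<comment> \<open>The blocks other than \<open>j\<close> contain exactly \<open>m\<close> closing
    ones, whatever \<open>b\<close> is.\<close>
  then have "m = count_list (take j ps) True + count_list (drop (Suc j) ps) True"
    unfolding cnt by (cases b) simp_all
  moreover have "ps[j := \<not> b] = take j ps @ (\<not> b) # drop (Suc j) ps"
    using j(1) len by (simp add: upd_conv_take_nth_drop)
  ultimately have "count_list (ps[j := \<not> b]) True = m + of_bool (\<not> b)"
    by (cases b) simp_all
  moreover have "list_all2 (\<lambda>y p. y \<in> core m l p) (bs[j := flip i (bs ! j)]) (ps[j := \<not> b])"
    using all i(2) by (rule list_all2_update_cong)
  ultimately show "flip (j * ?L + i) (concat bs @ [False]) \<in> core m (Suc l) (\<not> b)"
    unfolding eq core.simps using len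
    by (intro CollectI exI[of _ "bs[j := flip i (bs ! j)]"] exI[of _ "ps[j := \<not> b]"]) simp
qed

text \<open>At least \<open>m\<close> blocks have the type \<open>b\<close> of the whole string:
  \<open>m\<close> if \<open>b\<close> is opening, \<open>m + 1\<close> if it is closing. Each of
  them contributes the positions found one level below.\<close>

lemma core_sensitivity:
  "x \<in> core m l b \<Longrightarrow> m ^ l \<le> card {i. i < length x \<and> flip i x \<in> core m l (\<not> b)}"
proof (induction l arbitrary: x b)
  case 0
  then have "{i. i < length x \<and> flip i x \<in> core m 0 (\<not> b)} = {0}"
    by (auto simp: flip_def)
  then show ?case by simp
next
  case (Suc l)
  let ?L = "core_length m l"
  from Suc obtain bs ps where x: "x = concat bs @ [False]" and len: "length ps = 2 * m"
    and cnt: "count_list ps True = m + of_bool b"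
    and all: "list_all2 (\<lambda>y p. y \<in> core m l p) bs ps" by auto
  define J where "J = {j. j < 2 * m \<and> ps ! j = b}"
  define I where "I j = {i. i < length (bs ! j) \<and> flip i (bs ! j) \<in> core m l (\<not> b)}" for j
  have "count_list ps True + count_list ps False = length ps"
    by (induction ps) auto
  then have "m \<le> count_list ps b"
    using cnt len by (cases b) auto
  moreover have "count_list ps b = card J"
    by (simp add: J_def count_list_eq_length_filter length_filter_conv_card len eq_commute)
  ultimately have cJ: "m \<le> card J" by simp
  have blk: "bs ! j \<in> core m l b" if "j \<in> J" for j
    using all that len by (auto simp: list_all2_conv_all_nth J_def)
  have fin: "finite J" "finite (I j)" for j by (auto simp: J_def I_def)
  have "m * m ^ l \<le> card J * m ^ l" using cJ by simp
  also have "\<dots> \<le> (\<Sum>j\<in>J. card (I j))"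
    using sum_mono[of J "\<lambda>_. m ^ l" "\<lambda>j. card (I j)"] Suc.IH[OF blk] by (simp add: I_def)
  also have "\<dots> = card (Sigma J I)"
    using fin by simp
  also have "\<dots> \<le> card {i. i < length x \<and> flip i x \<in> core m (Suc l) (\<not> b)}"
  proof (rule card_inj_on_le)
    have "i < ?L" if "j \<in> J" "i \<in> I j" for i j
      using that length_core[OF blk] by (auto simp: I_def)
    \<comment> \<open>Division by the block length recovers \<open>j\<close> and \<open>i\<close>,
      so positions from different blocks are distinct.\<close>
    then have dm: "(j * ?L + i) div ?L = j" "(j * ?L + i) mod ?L = i" if "j \<in> J" "i \<in> I j" for i j
      using that by fastforce+
    show "inj_on (\<lambda>(j, i). j * ?L + i) (Sigma J I)"
      by (rule inj_onI) (clarsimp, metis dm)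
    have lx: "length x = 2 * m * ?L + 1" using length_core[OF Suc.prems] by simp
    show "(\<lambda>(j, i). j * ?L + i) ` Sigma J I \<subseteq> {i. i < length x \<and> flip i x \<in> core m (Suc l) (\<not> b)}"
      using flip_core_block[OF len cnt all] unfolding x[symmetric] lx
      by (fastforce simp: J_def I_def simp del: core.simps)
  qed simp
  finally show ?case by simp
qed

section \<open>Padding to inputs of the Dyck language\<close>

text \<open>The \<open>h\<close> opening parentheses lift the prefixes of \<open>x\<close> to
  nonnegative height, the \<open>h + 1\<close> closing ones bring a string of balance 1 back to 0,
  and the \<open>p\<close> pairs fill up the length.\<close>

definition dyck_input :: "nat \<Rightarrow> nat \<Rightarrow> bool list \<Rightarrow> bool list" where
  "dyck_input h p x =
     replicate h False @ x @ replicate (Suc h) True @ concat (replicate p [False, True])"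

lemma length_dyck_input: "length (dyck_input h p x) = length x + 2 * h + 1 + 2 * p"
proof -
  have "length (concat (replicate p [False, True])) = 2 * p"
    by (subst length_concat_uniform[of _ 2]) auto
  then show ?thesis by (simp add: dyck_input_def)
qed

lemma balance_prefix_replicate:
  assumes "prefix q (replicate k b)"
  obtains j where "j \<le> k" "balance q = (if b then - int j else int j)"
proof
  show "length q \<le> k" using prefix_length_le[OF assms] by simp
  have "replicate (length q) b = q"
    using set_mono_prefix[OF assms] by (intro replicate_eqI[symmetric]) auto
  then show "balance q = (if b then - int (length q) else int (length q))"
    using balance_replicate[of "length q" b] by simp
qed

lemma balance_pairs: "balance (concat (replicate p [False, True])) = 0"
  by (induction p) auto

lemma balance_prefix_pairs:
  "prefix q (concat (replicate p [False, True])) \<Longrightarrow> 0 \<le> balance q \<and> balance q \<le> 1"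
proof (induction p arbitrary: q)
  case (Suc p)
  then show ?case by (auto simp: prefix_Cons)
qed simp

lemma balance_dyck_input: "balance (dyck_input h p x) = balance x - 1"
  by (simp add: dyck_input_def balance_pairs)

text \<open>The height stays in [0, h] on the first segment and in [0, 2h] on \<open>x\<close>,
  falls from h + 1 to 0, and then alternates between 0 and 1. The ceiling \<open>2 * h\<close>
  admits h + 1 because \<open>h > 0\<close>.\<close>

lemma dyck_dyck_input:
  assumes bal: "balance x = 1" and h: "h > 0"
    and pre: "\<And>q. prefix q x \<Longrightarrow> \<bar>balance q\<bar> \<le> int h"
  shows "dyck (2 * h) (length (dyck_input h p x)) (dyck_input h p x)"
  unfolding dyck_def
proof (intro conjI allI impI)
  fix q assume q: "prefix q (dyck_input h p x)"
  have "0 \<le> balance q \<and> balance q \<le> int (2 * h)"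
  proof -
    from q consider "prefix q (replicate h False)"
      | r where "q = replicate h False @ r" "prefix r x"
      | r where "q = replicate h False @ x @ r" "prefix r (replicate (Suc h) True)"
      | r where "q = replicate h False @ x @ replicate (Suc h) True @ r"
          "prefix r (concat (replicate p [False, True]))"
      unfolding dyck_input_def prefix_append by blast
    then show ?thesis
    proof cases
      case 1
      then show ?thesis by (rule balance_prefix_replicate) auto
    next
      case 2
      then show ?thesis using pre[of r] by auto
    next
      case 3
      from 3(2) obtain j where "j \<le> Suc h" "balance r = - int j"
        by (rule balance_prefix_replicate) auto
      then show ?thesis using 3 bal h by auto
    next
      case 4
      then show ?thesis using balance_prefix_pairs[of r p] bal h by auto
    qed
  qed
  then show "0 \<le> balance q" "balance q \<le> int (2 * h)" by auto
qed (simp_all add: balance_dyck_input bal)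

lemma flip_dyck_input:
  "i < length x \<Longrightarrow> flip (h + i) (dyck_input h p x) = dyck_input h p (flip i x)"
  using flip_append_mid[of i x "replicate h False"] by (simp add: dyck_input_def)

lemma dyck_input_sensitivity:
  assumes "m ^ l \<le> card {i. i < length x \<and> flip i x \<in> C}"
    and "length (dyck_input h p x) = n"
  shows "m ^ l \<le> card {i. i < n \<and> flip i (dyck_input h p x) \<in> dyck_input h p ` C}"
proof -
  have "card {i. i < length x \<and> flip i x \<in> C}
      \<le> card {i. i < n \<and> flip i (dyck_input h p x) \<in> dyck_input h p ` C}"
    using assms(2) by (intro card_inj_on_le[where f = "\<lambda>i. h + i"])
      (auto simp: flip_dyck_input length_dyck_input)
  then show ?thesis using assms(1) by simp
qed

section \<open>Choice of the parameters and the lower bound\<close>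

text \<open>The summand 1 on the left absorbs the extra parenthesis of each level: 2mL + 2 is at
  most 2m(L + 1) for positive m, so the induction closes.\<close>

lemma core_length_bound: "m > 0 \<Longrightarrow> core_length m l + 1 \<le> 2 * (2 * m) ^ l"
proof (induction l)
  case (Suc l)
  then have "2 * m * (core_length m l + 1) \<le> 2 * m * (2 * (2 * m) ^ l)"
    by (intro mult_left_mono) auto
  then show ?case using Suc.prems by (simp add: algebra_simps)
qed simp

text \<open>Oddness leaves an even amount of space, to be filled with pairs.\<close>

lemma odd_core_length: "odd (core_length m l)"
  by (cases l) auto

lemma mult_le_power_double:
  fixes m :: nat
  assumes "m > 0"
  shows "l * m \<le> (2 * m) ^ l"
proof (induction l)
  case (Suc l)
  have "1 \<le> (2 * m) ^ l" using assms by simp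
  then have "m \<le> m * (2 * m) ^ l" "(2 * m) ^ l \<le> m * (2 * m) ^ l"
    using assms by simp_all
  then have "m + l * m \<le> m * (2 * m) ^ l + m * (2 * m) ^ l"
    using Suc by linarith
  then show ?case by (simp add: algebra_simps)
qed simp

lemma quantum_query_complexity_dyck_ge:
  assumes m: "m > 0" and l: "l > 0"
    and comp: "computable_with_queries (8 * (2 * m) ^ l) (dyck (6 * l * m) (8 * (2 * m) ^ l)) T"
  shows "m ^ l \<le> 36 * T"
proof -
  let ?n = "8 * (2 * m) ^ l"
  \<comment> \<open>For positive \<open>m\<close> and \<open>l\<close> this dominates the prefix
    bound \<open>1 + l * (m + 1)\<close>, and \<open>2 * h\<close> is the ceiling
    \<open>6 * l * m\<close>.\<close>
  define h where "h = 3 * l * m"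
  define p where "p = (?n - (core_length m l + 2 * h + 1)) div 2"
  \<comment> \<open>The core string and the extra 1 take at most \<open>2 * (2 * m) ^ l\<close>, and
    \<open>2 * h\<close> takes at most \<open>6 * (2 * m) ^ l\<close>; hence the factor 8.\<close>
  have "core_length m l + 2 * h + 1 \<le> ?n"
    using core_length_bound[OF m, of l] mult_le_power_double[OF m, of l] by (simp add: h_def)
  moreover have "even (?n - (core_length m l + 2 * h + 1))"
    using odd_core_length[of m l] by simp
  ultimately have n: "core_length m l + 2 * h + 1 + 2 * p = ?n"
    by (simp add: p_def)
  have len: "length (dyck_input h p x) = ?n" if "x \<in> core m l b" for x b
    using n length_core[OF that] by (simp add: length_dyck_input)
  have h: "1 + l * (m + 1) \<le> h" "h > 0"
  proof -
    have "1 \<le> l * m" "l \<le> l * m" using m l by simp_all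
    moreover have "h = l * m + l * m + l * m" by (simp add: h_def)
    moreover have "l * (m + 1) = l * m + l" by simp
    ultimately show "1 + l * (m + 1) \<le> h" "h > 0" by linarith+
  qed
  have k: "6 * l * m = 2 * h" by (simp add: h_def)
  show ?thesis
  proof (rule adversary_lower_bound[OF comp])
    show "0 < ?n" using m by simp
    show "dyck_input h p ` core m l False \<noteq> {}" using core_nonempty[OF m] by simp
    show "length x = ?n \<and> dyck (6 * l * m) ?n x" if x: "x \<in> dyck_input h p ` core m l False" for x
    proof -
      obtain c where c: "c \<in> core m l False" "x = dyck_input h p c" using x by blast
      have "balance c = 1" using balance_core[OF c(1)] by simp
      moreover have "\<bar>balance q\<bar> \<le> int h" if "prefix q c" for q
        using balance_prefix_core[OF c(1) that] h(1) by linarith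
      ultimately show ?thesis
        using dyck_dyck_input[of c h p] h(2) len[OF c(1)] c(2) by (simp add: k)
    qed
    show "length y = ?n \<and> \<not> dyck (6 * l * m) ?n y" if "y \<in> dyck_input h p ` core m l True" for y
      \<comment> \<open>The total balance is -1 - 1 = -2 instead of 0.\<close>
      using that len by (auto simp: dyck_def balance_dyck_input balance_core)
    show "m ^ l \<le> card {i. i < ?n \<and> flip i x \<in> dyck_input h p ` core m l True}"
      if "x \<in> dyck_input h p ` core m l False" for x
      using that dyck_input_sensitivity[OF core_sensitivity len] by fastforce
    show "m ^ l \<le> card {i. i < ?n \<and> flip i y \<in> dyck_input h p ` core m l False}"
      if "y \<in> dyck_input h p ` core m l True" for y
      using that dyck_input_sensitivity[OF core_sensitivity len] by fastforce
  qed
qed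

theorem theorem4:
  shows "\<exists>c1 c2 :: nat. c1 > 0 \<and> c2 > 0 \<and>
    (\<lambda>(m, l). real (quantum_query_complexity (c2 * (2 * m) ^ l)
                      (dyck (c1 * l * m) (c2 * (2 * m) ^ l))))
      \<in> \<Omega>[principal {(m, l). m > 0 \<and> l > 0}](\<lambda>(m :: nat, l :: nat). real m ^ l)"
proof (intro exI conjI)
  \<comment> \<open>The witnesses are \<open>c1 = 6\<close>, twice the 3 in the height offset, and
    \<open>c2 = 8\<close> from the length count; 36 is the adversary constant.\<close>
  have "real m ^ l / 36 \<le> real (quantum_query_complexity (8 * (2 * m) ^ l)
      (dyck (6 * l * m) (8 * (2 * m) ^ l)))" if "m > 0" "l > 0" for m l :: nat
  proof -
    have "m ^ l \<le> 36 * quantum_query_complexity (8 * (2 * m) ^ l) (dyck (6 * l * m) (8 * (2 * m) ^ l))"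
      using that by (intro quantum_query_complexity_dyck_ge computable_quantum_query_complexity) auto
    then have "real (m ^ l) \<le> real (36 * quantum_query_complexity (8 * (2 * m) ^ l) (dyck (6 * l * m) (8 * (2 * m) ^ l)))"
      by (simp only: of_nat_le_iff)
    then show ?thesis by simp
  qed
  then show "(\<lambda>(m, l). real (quantum_query_complexity (8 * (2 * m) ^ l)
                      (dyck (6 * l * m) (8 * (2 * m) ^ l))))
      \<in> \<Omega>[principal {(m, l). m > 0 \<and> l > 0}](\<lambda>(m :: nat, l :: nat). real m ^ l)"
    \<comment> \<open>Under the principal filter, eventually means for all positive \<open>m\<close>
      and \<open>l\<close>.\<close>
    by (intro landau_omega.bigI[of "1/36"]) (auto simp: eventually_principal)
qed simp_all

end
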